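(* Let $H$ be a separable Hilbert space, let $\{x_n\}_{n\in\mathbb{N}}$ be a Bessel-normalizable sequence of nonzero elements of $H$, let $\{y_n\}_{n\in\mathbb{N}}$ be a sequence of nonzero elements of $H$, and let $(m_n)_{n\in\mathbb{N}}$ be a sequence of scalars. Then $\sum_n m_n\langle x,y_n\rangle x_n$ converges unconditionally for all $x\in H$ if and only if $\{m_n\|x_n\|y_n\}$ is a Bessel sequence in $H$. Consequently, $\sum_n m_n\langle x,y_n\rangle x_n$ converges unconditionally for all $x\in H$ if and only if there exist sequences of scalars $(c_n)$ and $(d_n)$ with $c_n\overline{d_n}=m_n$ for all $n$ such that $\{c_nx_n\}$ and $\{d_ny_n\}$ are Bessel sequences in $H$.
   Context: A sequence $\{z_n\}$ in $H$ is a Bessel sequence if there is a constant $B$ with $\sum_n|\langle x,z_n\rangle|^2\le B\|x\|^2$ for all $x\in H$. A sequence $\{x_n\}$ of nonzero elements of $H$ is Bessel-normalizable if $\{x_n/\|x_n\|\}$ is a Bessel sequence in $H$. *)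

theory Defs
  imports "HOL-Analysis.Analysis"
begin

section \<open>Scalar fields\<close>

text \<open>
  HOL-Analysis only has real inner product spaces, so the scalars are made a parameter. By
  Frobenius's theorem \<^typ>\<open>real\<close> and \<^typ>\<open>complex\<close> are, up to isomorphism, the only instances of
  this class: \<open>a + sconj a\<close> and \<open>a * sconj a\<close> are real, so every element is a root of a real quadratic.
  The last axiom forces the conjugation to be the usual one.
\<close>

class rc_field = real_normed_field +
  fixes sconj :: "'a \<Rightarrow> 'a"
  assumes sconj_add: "sconj (a + b) = sconj a + sconj b"
    and sconj_mult: "sconj (a * b) = sconj a * sconj b"
    and mult_sconj: "a * sconj a = (norm a)\<^sup>2 *\<^sub>R 1"

instantiation real :: rc_field
begin

definition sconj_real :: "real \<Rightarrow> real" where "sconj_real a = a"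

instance
  by standard (simp_all add: sconj_real_def power2_eq_square)

end

instantiation complex :: rc_field
begin

definition sconj_complex :: "complex \<Rightarrow> complex" where "sconj_complex = cnj"

instance
proof
  fix a b :: complex
  show "sconj (a + b) = sconj a + sconj b" "sconj (a * b) = sconj a * sconj b"
    by (simp_all add: sconj_complex_def)
  show "a * sconj a = (norm a)\<^sup>2 *\<^sub>R 1"
    unfolding sconj_complex_def by (metis complex_norm_square of_real_def)
qed

end


section \<open>Hilbert spaces\<close>

text \<open>
  The space is a whole type; addition, topology and completeness come from the class
  \<^class>\<open>banach\<close>. The inner product is linear in its first argument. The axiom \<open>scale_of_real\<close>
  ties the scalar multiplication to the one built into \<^class>\<open>banach\<close>.
\<close>

locale hilbert_space = vector_space scale
  for scale :: "'k::rc_field \<Rightarrow> 'a::banach \<Rightarrow> 'a" +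
  fixes ip :: "'a \<Rightarrow> 'a \<Rightarrow> 'k"
  assumes scale_of_real: "scale (of_real r) x = r *\<^sub>R x"
    and ip_add_left: "ip (x + y) z = ip x z + ip y z"
    and ip_scale_left: "ip (scale a x) y = a * ip x y"
    and ip_sconj: "ip y x = sconj (ip x y)"
    and ip_self: "ip x x = of_real ((norm x)\<^sup>2)"

lemma hilbert_space_real_inner:
  "hilbert_space ((*\<^sub>R) :: real \<Rightarrow> 'a::{real_inner, banach} \<Rightarrow> 'a) inner"
  by unfold_locales
    (simp_all add: algebra_simps inner_commute sconj_real_def power2_norm_eq_inner)

lemma hilbert_space_complex:
  "hilbert_space ((*) :: complex \<Rightarrow> complex \<Rightarrow> complex) (\<lambda>a b. a * cnj b)"
  by unfold_locales
    (simp_all add: algebra_simps sconj_complex_def scaleR_conv_of_real complex_norm_square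
      del: of_real_power)


section \<open>Bessel sequences and unconditional convergence\<close>

text \<open>
  Summability is demanded explicitly, since \<^const>\<open>suminf\<close> of a divergent series is an
  unspecified value.
\<close>

definition bessel_sequence :: "('a::real_normed_vector \<Rightarrow> 'a \<Rightarrow> 'k::rc_field) \<Rightarrow> (nat \<Rightarrow> 'a) \<Rightarrow> bool"
  where "bessel_sequence ip z \<longleftrightarrow>
    (\<exists>B::real. \<forall>x. summable (\<lambda>n. (norm (ip x (z n)))\<^sup>2) \<and>
      (\<Sum>n. (norm (ip x (z n)))\<^sup>2) \<le> B * (norm x)\<^sup>2)"

definition bessel_normalizable :: "('a::real_normed_vector \<Rightarrow> 'a \<Rightarrow> 'k::rc_field) \<Rightarrow> (nat \<Rightarrow> 'a) \<Rightarrow> bool"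
  where "bessel_normalizable ip x \<longleftrightarrow>
    (\<forall>n. x n \<noteq> 0) \<and> bessel_sequence ip (\<lambda>n. x n /\<^sub>R norm (x n))"

definition converges_unconditionally :: "(nat \<Rightarrow> 'a::real_normed_vector) \<Rightarrow> bool"
  where "converges_unconditionally f \<longleftrightarrow> (\<forall>\<pi>. bij \<pi> \<longrightarrow> summable (\<lambda>n. f (\<pi> n)))"

end

theory Submission
  imports Defs
begin

text \<open>
  By Orlicz's theorem the terms of an unconditionally convergent series in a Hilbert space are
  square summable, so the coefficients \<open>\<langle>v, m\<^sub>n \<parallel>x\<^sub>n\<parallel> y\<^sub>n\<rangle>\<close> (up to conjugating \<open>m\<^sub>n\<close>) are square
  summable for every \<open>v\<close>, and uniform boundedness makes this a Bessel bound. Conversely, a Bessel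
  sequence with square summable coefficients converges unconditionally by Cauchy-Schwarz. The
  factorization is \<open>c\<^sub>n = 1 / \<parallel>x\<^sub>n\<parallel>\<close>; any other factorization is handled by moving \<open>d\<^sub>n\<close> into the
  inner product and \<open>c\<^sub>n\<close> onto \<open>x\<^sub>n\<close>.
\<close>

section \<open>Unconditional convergence\<close>

text \<open>Used to bring \<open>F\<close> to the front of its block while permuting only that
  block, so that a sum over consecutive indices becomes \<open>sum f F\<close>. Two bijections
  between sets of equal size are glued.\<close>

lemma ex_bij_betw_initial_segment:
  fixes N b :: nat
  assumes "F \<subseteq> {N..<b}"
  shows "\<exists>p. bij_betw p {N..<b} {N..<b} \<and> bij_betw p {N..<N + card F} F"
proof -
  have fin: "finite F" using assms finite_subset by blast
  have cb: "card F \<le> b - N" using card_mono[OF _ assms] by simp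
  obtain g where g: "bij_betw g {N..<N + card F} F"
    using finite_same_card_bij[of "{N..<N + card F}" F] fin by auto
  have "card ({N..<b} - F) = card {N + card F..<b}"
    using assms fin by (simp add: card_Diff_subset)
  then obtain h where h: "bij_betw h {N + card F..<b} ({N..<b} - F)"
    using finite_same_card_bij[of "{N + card F..<b}" "{N..<b} - F"] by auto
  define p where "p n = (if n < N + card F then g n else h n)" for n
  have pg: "bij_betw p {N..<N + card F} F"
    using g by (subst bij_betw_cong[of _ p g]) (auto simp: p_def)
  have ph: "bij_betw p {N + card F..<b} ({N..<b} - F)"
    using h by (subst bij_betw_cong[of _ p h]) (auto simp: p_def)
  have "bij_betw p ({N..<N + card F} \<union> {N + card F..<b}) (F \<union> ({N..<b} - F))"
    by (rule bij_betw_combine[OF pg ph]) auto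
  moreover have "{N..<N + card F} \<union> {N + card F..<b} = {N..<b}"
    using cb assms by (cases "F = {}") (auto simp: ivl_disj_un)
  moreover have "F \<union> ({N..<b} - F) = {N..<b}" using assms by auto
  ultimately show ?thesis using pg by auto
qed

text \<open>
  Otherwise there are consecutive intervals each containing a set with a large partial sum; the
  permutation that moves these sets to the front of their intervals destroys the Cauchy property.
\<close>

lemma converges_unconditionally_Cauchy:
  fixes f :: "nat \<Rightarrow> 'a::banach"
  assumes "converges_unconditionally f" and "e > 0"
  shows "\<exists>N. \<forall>F. finite F \<and> F \<subseteq> {N..} \<longrightarrow> norm (sum f F) < e"
proof (rule ccontr)
  assume "\<not> ?thesis"
  then have "\<forall>N. \<exists>F. finite F \<and> F \<subseteq> {N..} \<and> e \<le> norm (sum f F)"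
    by (meson not_less)
  then obtain F where F: "\<And>N. finite (F N)" "\<And>N. F N \<subseteq> {N..}" "\<And>N. e \<le> norm (sum f (F N))"
    by metis
  have "\<exists>b. N < b \<and> F N \<subseteq> {N..<b}" for N :: nat
  proof -
    obtain k where "\<And>n. n \<in> F N \<Longrightarrow> n < k"
      using F(1)[of N] by (meson finite_nat_set_iff_bounded)
    then show ?thesis using F(2)[of N] by (intro exI[of _ "max (Suc N) k"]) fastforce
  qed
  then obtain b where b: "\<And>N. N < b N" "\<And>N. F N \<subseteq> {N..<b N}" by metis
  obtain p where p: "\<And>N. bij_betw (p N) {N..<b N} {N..<b N}"
      "\<And>N. bij_betw (p N) {N..<N + card (F N)} (F N)"
    using ex_bij_betw_initial_segment[OF b(2)] by metis
  \<comment> \<open>Iterating \<open>b\<close> from 0 makes each block start where the previous one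
    ends, so the blocks tile the naturals and the block of \<open>k\<close> contains
    \<open>F (a k)\<close>.\<close>
  define a where "a k = (b ^^ k) 0" for k
  have a0: "a 0 = 0" and aS: "a (Suc k) = b (a k)" for k by (simp_all add: a_def)
  have mono: "strict_mono a" by (rule strict_mono_Suc_iff[THEN iffD2]) (simp add: aS b)
  define I where "I k = {a k..<a (Suc k)}" for k
  have unique: "i = j" if "n \<in> I i" "n \<in> I j" for i j n
  proof -
    have "i < Suc j" "j < Suc i"
      using that strict_mono_less[OF mono] unfolding I_def
      by (meson atLeastLessThan_iff le_less_trans)+
    then show ?thesis by simp
  qed
  have cover: "\<exists>k. n \<in> I k" for n
  proof -
    define k where "k = (LEAST k. n < a (Suc k))"
    have "n < a (Suc n)" using strict_mono_imp_increasing[OF mono, of "Suc n"] by simp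
    then have "n < a (Suc k)" unfolding k_def by (rule LeastI)
    moreover have "a k \<le> n"
    proof (cases k)
      case (Suc j)
      then have "\<not> n < a (Suc j)" using not_less_Least[of j "\<lambda>k. n < a (Suc k)"] by (simp add: k_def)
      with Suc show ?thesis by simp
    qed (simp add: a0)
    ultimately show ?thesis by (auto simp: I_def)
  qed
  define \<pi> where "\<pi> n = p (a (THE k. n \<in> I k)) n" for n
  have \<pi>: "\<pi> n = p (a k) n" if "n \<in> I k" for n k
  proof -
    have "(THE k. n \<in> I k) = k" using that unique by blast
    then show ?thesis by (simp add: \<pi>_def)
  qed
  have "bij_betw \<pi> (\<Union>k\<in>UNIV. I k) (\<Union>k\<in>UNIV. I k)"
  proof (rule bij_betw_UNION_disjoint)
    show "disjoint_family_on I UNIV" using unique by (auto simp: disjoint_family_on_def)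
    show "bij_betw \<pi> (I k) (I k)" for k
      using p(1)[of "a k"] bij_betw_cong[of "I k" \<pi> "p (a k)" "I k"] \<pi> by (simp add: I_def aS)
  qed
  then have "bij \<pi>" using cover by (metis UNIV_eq_I UN_I UNIV_I)
  then have "summable (\<lambda>n. f (\<pi> n))" using assms(1) by (simp add: converges_unconditionally_def)
  then obtain N where N: "\<And>m n. m \<ge> N \<Longrightarrow> norm (\<Sum>i\<in>{m..<n}. f (\<pi> i)) < e"
    using \<open>e > 0\<close> unfolding summable_Cauchy by meson
  \<comment> \<open>The front of block \<open>N\<close> is carried onto \<open>F (a N)\<close>.
    Strict monotonicity gives \<open>N\<close> \<le> \<open>a N\<close>, so the Cauchy estimate
    applies and contradicts the choice of \<open>F\<close>.\<close>
  let ?J = "{a N..<a N + card (F (a N))}"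
  have "card (F (a N)) \<le> b (a N) - a N" using card_mono[OF _ b(2)[of "a N"]] by simp
  then have "?J \<subseteq> I N" using b(1)[of "a N"] by (auto simp: I_def aS)
  then have "(\<Sum>i\<in>?J. f (\<pi> i)) = (\<Sum>i\<in>?J. f (p (a N) i))" using \<pi> by (intro sum.cong) auto
  also have "\<dots> = sum f (F (a N))" by (rule sum.reindex_bij_betw[OF p(2)])
  finally show False
    using N[of "a N" "a N + card (F (a N))"] F(3)[of "a N"] strict_mono_imp_increasing[OF mono, of N]
    by simp
qed

text \<open>Sets beyond some \<open>N\<close> have sums of norm below 1; the indices below
  \<open>N\<close> contribute at most the sum of their norms.\<close>

lemma converges_unconditionally_bounded:
  fixes f :: "nat \<Rightarrow> 'a::banach"
  assumes "converges_unconditionally f"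
  shows "\<exists>C. \<forall>F. finite F \<longrightarrow> norm (sum f F) \<le> C"
proof -
  obtain N where N: "\<And>F. finite F \<Longrightarrow> F \<subseteq> {N..} \<Longrightarrow> norm (sum f F) < 1"
    using converges_unconditionally_Cauchy[OF assms, of 1] by auto
  have "norm (sum f F) \<le> (\<Sum>n<N. norm (f n)) + 1" if "finite F" for F
  proof -
    have "sum f F = sum f (F \<inter> {..<N}) + sum f (F - {..<N})" by (rule sum.Int_Diff[OF that])
    also have "norm \<dots> \<le> (\<Sum>n\<in>F \<inter> {..<N}. norm (f n)) + 1"
      using that by (intro norm_triangle_mono sum_norm_le less_imp_le[OF N]) auto
    also have "\<dots> \<le> (\<Sum>n<N. norm (f n)) + 1" by (intro add_right_mono sum_mono2) auto
    finally show ?thesis .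
  qed
  then show ?thesis by blast
qed


section \<open>Hilbert spaces over a general scalar field\<close>

lemma sconj_0 [simp]: "sconj (0::'k::rc_field) = 0"
  using sconj_add[of "0::'k" 0] by simp

text \<open>Not an axiom of the class: it follows from \<open>mult_sconj\<close> by cancelling a
  nonzero factor, as do norm preservation and involutivity below.\<close>

lemma sconj_of_real [simp]: "sconj (of_real r) = (of_real r :: 'k::rc_field)"
proof (cases "r = 0")
  case False
  have "of_real r * sconj (of_real r) = (of_real r * of_real r :: 'k)"
    unfolding mult_sconj by (simp add: power2_eq_square of_real_def)
  with False show ?thesis by simp
qed simp

lemma norm_sconj [simp]: "norm (sconj a) = norm (a::'k::rc_field)"
proof (cases "a = 0")
  case False
  have "norm a * norm (sconj a) = norm a * norm a"
    using mult_sconj[of a] by (simp flip: norm_mult add: power2_eq_square)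
  with False show ?thesis by simp
qed simp

lemma sconj_sconj [simp]: "sconj (sconj a) = (a::'k::rc_field)"
proof (cases "a = 0")
  case False
  have "sconj a * sconj (sconj a) = sconj a * a"
    using mult_sconj[of "sconj a"] mult_sconj[of a] by (simp add: mult.commute)
  moreover have "sconj a \<noteq> 0" using False by (metis norm_sconj norm_eq_zero)
  ultimately show ?thesis by simp
qed simp

context hilbert_space
begin

lemma ip_diff_left: "ip (u - v) w = ip u w - ip v w"
  using ip_add_left[of "u - v" v w] by (simp add: eq_diff_eq)

lemma ip_0_left [simp]: "ip 0 w = 0"
  using ip_diff_left[of 0 0 w] by simp

lemma ip_add_right: "ip w (u + v) = ip w u + ip w v"
  by (metis ip_sconj ip_add_left sconj_add)

lemma ip_0_right [simp]: "ip w 0 = 0"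
  by (metis ip_sconj ip_0_left sconj_0)

lemma ip_diff_right: "ip w (u - v) = ip w u - ip w v"
  using ip_add_right[of w "u - v" v] by (simp add: eq_diff_eq)

lemma ip_scale_right: "ip w (scale a v) = sconj a * ip w v"
  by (metis ip_sconj ip_scale_left sconj_mult)

lemma norm_ip_commute: "norm (ip u v) = norm (ip v u)"
  by (metis ip_sconj norm_sconj)

lemma ip_sum_left: "ip (\<Sum>i\<in>F. f i) w = (\<Sum>i\<in>F. ip (f i) w)"
  by (induction F rule: infinite_finite_induct) (simp_all add: ip_add_left)

text \<open>For scalars that are not real, norm and \<open>scale\<close> are linked only through
  \<open>ip\<close>, so the squared norms are compared as values of \<open>ip\<close>.\<close>

lemma norm_scale: "norm (scale a v) = norm a * norm v"
proof -
  have "(of_real ((norm (scale a v))\<^sup>2) :: 'k) = a * sconj a * ip v v"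
    by (simp only: ip_self[symmetric]) (simp add: ip_scale_left ip_scale_right)
  also have "\<dots> = of_real ((norm a * norm v)\<^sup>2)"
    by (simp add: mult_sconj ip_self power_mult_distrib flip: scaleR_conv_of_real)
      (simp add: scaleR_conv_of_real)
  finally show ?thesis by (simp only: of_real_eq_iff) (simp add: power2_eq_iff_nonneg)
qed

lemma parallelogram:
  fixes u v :: 'a
  shows "(norm (u + v))\<^sup>2 + (norm (u - v))\<^sup>2 = 2 * (norm u)\<^sup>2 + 2 * (norm v)\<^sup>2"
proof -
  have "ip (u + v) (u + v) + ip (u - v) (u - v) = 2 * ip u u + 2 * ip v v"
    by (simp add: ip_add_left ip_add_right ip_diff_left ip_diff_right)
  then have "(of_real ((norm (u + v))\<^sup>2 + (norm (u - v))\<^sup>2) :: 'k)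
      = of_real (2 * (norm u)\<^sup>2 + 2 * (norm v)\<^sup>2)"
    by (simp add: ip_self)
  then show ?thesis by (simp only: of_real_eq_iff)
qed

lemma ip_Cauchy_Schwarz: "norm (ip v z) \<le> norm v * norm z"
proof (cases "z = 0")
  case False
  let ?a = "ip v z"
  \<comment> \<open>This is the component of \<open>v\<close> orthogonal to \<open>z\<close>,
    multiplied by the squared norm of \<open>z\<close> to avoid division. The inequality is then the
    nonnegativity of its squared norm.\<close>
  define w where "w = scale (of_real ((norm z)\<^sup>2)) v - scale ?a z"
  have "ip w v = of_real ((norm z)\<^sup>2) * ip v v - ?a * sconj ?a"
    by (simp add: w_def ip_diff_left ip_scale_left ip_sconj[of v z])
  also have "\<dots> = of_real ((norm z)\<^sup>2 * (norm v)\<^sup>2 - (norm ?a)\<^sup>2)"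
    by (simp add: mult_sconj ip_self of_real_def scaleR_diff_left mult.commute)
  finally have wv: "ip v w = of_real ((norm z)\<^sup>2 * (norm v)\<^sup>2 - (norm ?a)\<^sup>2)"
    by (metis ip_sconj sconj_of_real)
  have "ip w z = 0" by (simp add: w_def ip_diff_left ip_scale_left ip_self)
  then have wz: "ip z w = 0" by (metis ip_sconj sconj_0)
  have "ip w w = of_real ((norm z)\<^sup>2) * ip v w"
    by (subst w_def, simp only: ip_diff_left ip_scale_left wz) simp
  then have "(norm w)\<^sup>2 = (norm z)\<^sup>2 * ((norm z)\<^sup>2 * (norm v)\<^sup>2 - (norm ?a)\<^sup>2)"
    unfolding wv ip_self by (simp only: of_real_mult[symmetric] of_real_eq_iff)
  then have "0 \<le> (norm z)\<^sup>2 * ((norm z)\<^sup>2 * (norm v)\<^sup>2 - (norm ?a)\<^sup>2)" by (metis zero_le_power2)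
  then have "(norm ?a)\<^sup>2 \<le> (norm v * norm z)\<^sup>2"
    using False by (simp add: zero_le_mult_iff power_mult_distrib mult.commute)
  then show ?thesis by (rule power2_le_imp_le) simp
qed simp

lemma continuous_on_ip_left: "continuous_on S (\<lambda>v. ip v z)"
proof (rule continuous_onI)
  fix v e :: real assume "e > 0"
  show "\<exists>d>0. \<forall>v'\<in>S. dist v' v < d \<longrightarrow> dist (ip v' z) (ip v z) \<le> e" for v
  proof (intro exI conjI ballI impI)
    \<comment> \<open>Adding 1 keeps the denominator positive when \<open>z\<close> is zero.\<close>
    show "e / (norm z + 1) > 0" using \<open>e > 0\<close> by (simp add: add_nonneg_pos)
    fix v' assume "dist v' v < e / (norm z + 1)"
    then have "norm (v' - v) * (norm z + 1) < e"
      by (simp add: dist_norm pos_less_divide_eq add_nonneg_pos)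
    moreover have "norm (ip (v' - v) z) \<le> norm (v' - v) * (norm z + 1)"
      using ip_Cauchy_Schwarz[of "v' - v" z] by (simp add: distrib_left add_increasing2)
    ultimately show "dist (ip v' z) (ip v z) \<le> e" by (simp add: dist_norm ip_diff_left)
  qed
qed


section \<open>Orlicz's theorem\<close>

text \<open>The signs are chosen greedily: by the parallelogram law one of the two choices is good.\<close>

lemma ex_large_signed_sum:
  fixes f :: "nat \<Rightarrow> 'a"
  assumes "finite F"
  shows "\<exists>G\<subseteq>F. (\<Sum>n\<in>F. (norm (f n))\<^sup>2) \<le> (norm (sum f G - sum f (F - G)))\<^sup>2"
  using assms
proof (induction F)
  case (insert n F)
  then obtain G where G: "G \<subseteq> F" "(\<Sum>n\<in>F. (norm (f n))\<^sup>2) \<le> (norm (sum f G - sum f (F - G)))\<^sup>2"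
    by auto
  let ?s = "sum f G - sum f (F - G)"
  have fin: "finite G" "n \<notin> G" using G insert.hyps finite_subset by auto
  have plus: "sum f (insert n G) - sum f (insert n F - insert n G) = ?s + f n"
  proof -
    have "insert n F - insert n G = F - G" using insert.hyps by auto
    then show ?thesis using fin by simp
  qed
  have minus: "sum f G - sum f (insert n F - G) = ?s - f n"
    using fin insert.hyps by (simp add: insert_Diff_if)
  consider "(norm ?s)\<^sup>2 + (norm (f n))\<^sup>2 \<le> (norm (?s + f n))\<^sup>2"
    | "(norm ?s)\<^sup>2 + (norm (f n))\<^sup>2 \<le> (norm (?s - f n))\<^sup>2"
    using parallelogram[of ?s "f n"] by linarith
  then show ?case
  proof cases
    case 1
    then have "(\<Sum>n\<in>insert n F. (norm (f n))\<^sup>2)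
        \<le> (norm (sum f (insert n G) - sum f (insert n F - insert n G)))\<^sup>2"
      unfolding plus using G insert.hyps by simp
    then show ?thesis using G(1) by (intro exI[of _ "insert n G"]) auto
  next
    case 2
    then have "(\<Sum>n\<in>insert n F. (norm (f n))\<^sup>2)
        \<le> (norm (sum f G - sum f (insert n F - G)))\<^sup>2"
      unfolding minus using G insert.hyps by simp
    then show ?thesis using G(1) by (intro exI[of _ G]) auto
  qed
qed simp

text \<open>A signed sum is a difference of two subset sums, each bounded by \<open>C\<close>, so
  the square sums are bounded by the square of \<open>C + C\<close> independently of
  \<open>N\<close>.\<close>

lemma converges_unconditionally_summable_norm_square:
  fixes f :: "nat \<Rightarrow> 'a"
  assumes "converges_unconditionally f"
  shows "summable (\<lambda>n. (norm (f n))\<^sup>2)"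
proof -
  obtain C where C: "\<And>F. finite F \<Longrightarrow> norm (sum f F) \<le> C"
    using converges_unconditionally_bounded[OF assms] by blast
  show ?thesis
  proof (rule bounded_imp_summable)
    fix N :: nat
    obtain G where G: "G \<subseteq> {..N}"
      "(\<Sum>n\<le>N. (norm (f n))\<^sup>2) \<le> (norm (sum f G - sum f ({..N} - G)))\<^sup>2"
      using ex_large_signed_sum[of "{..N}" f] by auto
    have "norm (sum f G - sum f ({..N} - G)) \<le> C + C"
      using G(1) by (intro order_trans[OF norm_triangle_ineq4] add_mono C) (auto intro: finite_subset)
    then have "(norm (sum f G - sum f ({..N} - G)))\<^sup>2 \<le> (C + C)\<^sup>2" by (intro power_mono) auto
    with G(2) show "(\<Sum>n\<le>N. (norm (f n))\<^sup>2) \<le> (C + C)\<^sup>2" by linarith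
  qed simp
qed


section \<open>Bessel sequences\<close>

text \<open>
  Uniform boundedness: by Baire, one of the closed sets where the square sum is at most \<open>k\<close>
  contains a ball, and a ball around \<open>0\<close> is obtained by differences.
\<close>

lemma bessel_sequenceI_summable:
  assumes "\<And>v. summable (\<lambda>n. (norm (ip v (z n)))\<^sup>2)"
  shows "bessel_sequence ip z"
proof -
  define S where "S v = (\<Sum>n. (norm (ip v (z n)))\<^sup>2)" for v
  \<comment> \<open>Bounding all partial sums instead of \<open>S\<close> makes \<open>A k\<close>
    an intersection of closed conditions, without any continuity of \<open>S\<close>.\<close>
  define A where "A k = {v. \<forall>N. (\<Sum>n<N. (norm (ip v (z n)))\<^sup>2) \<le> real k}" for k
  have S_le: "S v \<le> real k" if "v \<in> A k" for v k
    using that assms unfolding S_def A_def by (intro suminf_le_const) auto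
  have closed: "closed (A k)" for k
    unfolding A_def
    by (intro closed_Collect_all closed_Collect_le continuous_intros continuous_on_ip_left)
  have cover: "(\<Union>k. A k) = UNIV"
  proof -
    have "\<exists>k. v \<in> A k" for v
    proof -
      obtain k where "S v \<le> real k" using real_arch_simple by blast
      then have "(\<Sum>n<N. (norm (ip v (z n)))\<^sup>2) \<le> real k" for N
        using sum_le_suminf[OF assms, of "{..<N}"] unfolding S_def by (meson finite_lessThan order_trans zero_le_power2)
      then show ?thesis by (auto simp: A_def)
    qed
    then show ?thesis by blast
  qed
  have "\<exists>k. interior (A k) \<noteq> {}"
  proof (rule ccontr)
    assume "\<not> ?thesis"
    then have "euclidean interior_of \<Union>(range A) = {}"
      using closed completely_metrizable_space_euclidean by (intro Baire_category_alt) auto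
    then show False by (simp add: cover)
  qed
  then obtain k v0 where "v0 \<in> interior (A k)" by blast
  then obtain r where r: "r > 0" "ball v0 r \<subseteq> A k" by (meson mem_interior)
  \<comment> \<open>Write \<open>w\<close> as \<open>(v0 + w) - v0\<close>, with both points in
    \<open>A k\<close>; the factor 4 comes from |a - b|^2 \<le> 2|a|^2 + 2|b|^2.\<close>
  have small: "S w \<le> 4 * real k" if "norm w < r" for w
  proof -
    have in_A: "v0 + w \<in> A k" "v0 \<in> A k" using r that by (auto simp: dist_norm subset_iff)
    have "(norm (ip w (z n)))\<^sup>2 \<le> 2 * (norm (ip (v0 + w) (z n)))\<^sup>2 + 2 * (norm (ip v0 (z n)))\<^sup>2" for n
    proof -
      have "norm (ip w (z n)) \<le> norm (ip (v0 + w) (z n)) + norm (ip v0 (z n))"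
        using norm_triangle_ineq4[of "ip (v0 + w) (z n)" "ip v0 (z n)"] by (simp add: ip_add_left)
      then have "(norm (ip w (z n)))\<^sup>2 \<le> (norm (ip (v0 + w) (z n)) + norm (ip v0 (z n)))\<^sup>2"
        by (intro power_mono) auto
      also have "\<dots> \<le> 2 * (norm (ip (v0 + w) (z n)))\<^sup>2 + 2 * (norm (ip v0 (z n)))\<^sup>2"
        using sum_squares_bound[of "norm (ip (v0 + w) (z n))" "norm (ip v0 (z n))"]
        by (simp add: power2_sum)
      finally show ?thesis .
    qed
    then have "S w \<le> (\<Sum>n. 2 * (norm (ip (v0 + w) (z n)))\<^sup>2 + 2 * (norm (ip v0 (z n)))\<^sup>2)"
      unfolding S_def by (intro suminf_le summable_add summable_mult assms)
    also have "\<dots> = 2 * S (v0 + w) + 2 * S v0"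
      unfolding S_def by (simp add: suminf_add[symmetric] suminf_mult summable_mult assms)
    finally show ?thesis using in_A[THEN S_le] by linarith
  qed
  have "S v \<le> 4 * real k * (2 / r)\<^sup>2 * (norm v)\<^sup>2" for v
  proof (cases "v = 0")
    case False
    \<comment> \<open>Rescales \<open>v\<close> to norm \<open>r / 2\<close>, inside the ball;
      \<open>S\<close> is homogeneous of degree 2.\<close>
    define t where "t = r / (2 * norm v)"
    have t: "t > 0" "norm (t *\<^sub>R v) < r" using False r by (auto simp: t_def)
    have "S (t *\<^sub>R v) = t\<^sup>2 * S v"
      unfolding S_def scale_of_real[symmetric]
      by (simp add: ip_scale_left norm_mult power_mult_distrib suminf_mult assms)
    then have "S v \<le> 4 * real k / t\<^sup>2" using small[OF t(2)] t(1) by (simp add: field_simps)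
    also have "\<dots> = 4 * real k * (2 / r)\<^sup>2 * (norm v)\<^sup>2"
      using r False by (simp add: t_def field_simps power2_eq_square)
    finally show ?thesis .
  qed (simp add: S_def)
  then show ?thesis unfolding bessel_sequence_def S_def using assms by blast
qed

text \<open>Expand only the first argument of \<open>ip s s\<close>, apply Cauchy-Schwarz to the
  finite sum, use the Bessel bound at \<open>s\<close> itself and cancel the squared norm of
  \<open>s\<close>.\<close>

lemma norm_sum_scale_le_bessel:
  assumes "0 \<le> B"
    and B: "\<And>v. (\<Sum>n\<in>F. (norm (ip v (w n)))\<^sup>2) \<le> B * (norm v)\<^sup>2"
  shows "(norm (\<Sum>n\<in>F. scale (c n) (w n)))\<^sup>2 \<le> B * (\<Sum>n\<in>F. (norm (c n))\<^sup>2)"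
proof -
  define s where "s = (\<Sum>n\<in>F. scale (c n) (w n))"
  have "(of_real ((norm s)\<^sup>2) :: 'k) = (\<Sum>n\<in>F. c n * ip (w n) s)"
    unfolding ip_self[symmetric] by (subst s_def) (simp add: ip_sum_left ip_scale_left)
  then have "(norm s)\<^sup>2 = norm (\<Sum>n\<in>F. c n * ip (w n) s)" by (metis norm_of_real abs_power2)
  also have "\<dots> \<le> (\<Sum>n\<in>F. norm (c n) * norm (ip s (w n)))"
    by (rule sum_norm_le) (simp add: norm_mult norm_ip_commute)
  finally have "((norm s)\<^sup>2)\<^sup>2 \<le> (\<Sum>n\<in>F. norm (c n) * norm (ip s (w n)))\<^sup>2" by (intro power_mono) auto
  also have "\<dots> \<le> (\<Sum>n\<in>F. (norm (c n))\<^sup>2) * (\<Sum>n\<in>F. (norm (ip s (w n)))\<^sup>2)"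
    by (rule Cauchy_Schwarz_ineq_sum)
  also have "\<dots> \<le> (\<Sum>n\<in>F. (norm (c n))\<^sup>2) * (B * (norm s)\<^sup>2)"
    by (intro mult_left_mono B sum_nonneg) simp
  finally have "(norm s)\<^sup>2 * (norm s)\<^sup>2 \<le> (B * (\<Sum>n\<in>F. (norm (c n))\<^sup>2)) * (norm s)\<^sup>2"
    by (simp add: power2_eq_square mult_ac)
  \<comment> \<open>Covers the case where \<open>s\<close> is zero and nothing can be
    cancelled.\<close>
  moreover have "0 \<le> B * (\<Sum>n\<in>F. (norm (c n))\<^sup>2)" using \<open>0 \<le> B\<close> by (simp add: sum_nonneg)
  ultimately show ?thesis unfolding s_def[symmetric] by (metis mult_right_le_imp_le zero_less_norm_iff zero_less_power zero_power2 norm_zero)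
qed

text \<open>Both hypotheses survive a permutation, since they concern series of nonnegative terms.
  Tails of the coefficient series then control tails of the vector series.\<close>

lemma converges_unconditionally_scale_bessel:
  assumes "bessel_sequence ip w" and c: "summable (\<lambda>n. (norm (c n))\<^sup>2)"
  shows "converges_unconditionally (\<lambda>n. scale (c n) (w n))"
  unfolding converges_unconditionally_def
proof (intro allI impI)
  fix \<pi> :: "nat \<Rightarrow> nat" assume \<pi>: "bij \<pi>"
  obtain B0 where w: "\<And>v. summable (\<lambda>n. (norm (ip v (w n)))\<^sup>2)"
      "\<And>v. (\<Sum>n. (norm (ip v (w n)))\<^sup>2) \<le> B0 * (norm v)\<^sup>2"
    using assms(1) unfolding bessel_sequence_def by blast
  \<comment> \<open>A positive bound allows division by \<open>B\<close> in the tail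
    estimate.\<close>
  define B where "B = max B0 1"
  have "B > 0" by (simp add: B_def)
  have inj: "inj_on \<pi> F" for F using \<pi> by (meson bij_is_inj inj_on_subset subset_UNIV)
  have B: "(\<Sum>n\<in>F. (norm (ip v (w (\<pi> n))))\<^sup>2) \<le> B * (norm v)\<^sup>2" if "finite F" for F v
  proof -
    have "(\<Sum>n\<in>F. (norm (ip v (w (\<pi> n))))\<^sup>2) = (\<Sum>n\<in>\<pi> ` F. (norm (ip v (w n)))\<^sup>2)"
      by (simp add: sum.reindex inj)
    also have "\<dots> \<le> (\<Sum>n. (norm (ip v (w n)))\<^sup>2)" using that w(1) by (intro sum_le_suminf) auto
    also have "\<dots> \<le> B0 * (norm v)\<^sup>2" by (rule w(2))
    also have "\<dots> \<le> B * (norm v)\<^sup>2" by (intro mult_right_mono) (auto simp: B_def)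
    finally show ?thesis .
  qed
  have "summable (\<lambda>n. (norm (c (\<pi> n)))\<^sup>2)"
    using summable_reindex[OF c bij_is_inj[OF \<pi>]] by (simp add: o_def)
  then have tail: "\<exists>N. \<forall>m\<ge>N. \<forall>n. norm (\<Sum>i\<in>{m..<n}. (norm (c (\<pi> i)))\<^sup>2) < e" if "e > 0" for e
    using that unfolding summable_Cauchy by blast
  show "summable (\<lambda>n. scale (c (\<pi> n)) (w (\<pi> n)))"
    unfolding summable_Cauchy
  proof (intro allI impI)
    fix e :: real assume "e > 0"
    then obtain N where N: "\<And>m n. m \<ge> N \<Longrightarrow> norm (\<Sum>i\<in>{m..<n}. (norm (c (\<pi> i)))\<^sup>2) < e\<^sup>2 / B"
      using tail[of "e\<^sup>2 / B"] \<open>B > 0\<close> by auto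
    have "norm (\<Sum>i\<in>{m..<n}. scale (c (\<pi> i)) (w (\<pi> i))) < e" if "m \<ge> N" for m n
    proof (rule power2_less_imp_less)
      have "(norm (\<Sum>i\<in>{m..<n}. scale (c (\<pi> i)) (w (\<pi> i))))\<^sup>2 \<le> B * (\<Sum>i\<in>{m..<n}. (norm (c (\<pi> i)))\<^sup>2)"
        using \<open>B > 0\<close> by (intro norm_sum_scale_le_bessel B) auto
      also have "\<dots> < B * (e\<^sup>2 / B)"
        using N[OF that, of n] \<open>B > 0\<close> by (intro mult_strict_left_mono) auto
      finally show "(norm (\<Sum>i\<in>{m..<n}. scale (c (\<pi> i)) (w (\<pi> i))))\<^sup>2 < e\<^sup>2" using \<open>B > 0\<close> by simp
    qed (use \<open>e > 0\<close> in simp)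
    then show "\<exists>N. \<forall>m\<ge>N. \<forall>n. norm (\<Sum>i\<in>{m..<n}. scale (c (\<pi> i)) (w (\<pi> i))) < e" by blast
  qed
qed

text \<open>Lets a scalar in front of a vector be exchanged for its conjugate.\<close>

lemma bessel_sequence_cong_norm:
  assumes "\<And>v n. norm (ip v (z n)) = norm (ip v (z' n))"
  shows "bessel_sequence ip z \<longleftrightarrow> bessel_sequence ip z'"
  by (simp add: bessel_sequence_def assms)

text \<open>The second sequence supplies square summable coefficients, the first the
  vectors.\<close>

lemma converges_unconditionally_bessel_pair:
  assumes "bessel_sequence ip (\<lambda>n. scale (c n) (x n))" "bessel_sequence ip (\<lambda>n. scale (d n) (y n))"
  shows "converges_unconditionally (\<lambda>n. scale (c n * sconj (d n) * ip v (y n)) (x n))"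
proof -
  have "converges_unconditionally (\<lambda>n. scale (ip v (scale (d n) (y n))) (scale (c n) (x n)))"
    using assms by (intro converges_unconditionally_scale_bessel) (auto simp: bessel_sequence_def)
  then show ?thesis by (simp add: ip_scale_right mult_ac)
qed

lemma bessel_sequence_if_converges_unconditionally:
  assumes "\<And>v. converges_unconditionally (\<lambda>n. scale (m n * ip v (y n)) (x n))"
  shows "bessel_sequence ip (\<lambda>n. scale (m n * of_real (norm (x n))) (y n))"
proof (rule bessel_sequenceI_summable)
  fix v
  have "norm (ip v (scale (m n * of_real (norm (x n))) (y n))) = norm (scale (m n * ip v (y n)) (x n))" for n
    by (simp add: ip_scale_right norm_scale norm_mult)
  then show "summable (\<lambda>n. (norm (ip v (scale (m n * of_real (norm (x n))) (y n))))\<^sup>2)"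
    using converges_unconditionally_summable_norm_square[OF assms[of v]] by simp
qed

end

theorem proposition5p3:
  fixes scale :: "'k::rc_field \<Rightarrow> 'a::banach \<Rightarrow> 'a"
    and ip :: "'a \<Rightarrow> 'a \<Rightarrow> 'k"
    and x y :: "nat \<Rightarrow> 'a"
    and m :: "nat \<Rightarrow> 'k"
  assumes "hilbert_space scale ip"
    and "separable_space (euclidean :: 'a topology)"
    and "\<And>n. x n \<noteq> 0"
    and "bessel_normalizable ip x"
    and "\<And>n. y n \<noteq> 0"
  shows "((\<forall>v. converges_unconditionally (\<lambda>n. scale (m n * ip v (y n)) (x n))) \<longleftrightarrow>
          bessel_sequence ip (\<lambda>n. scale (m n * of_real (norm (x n))) (y n)))
       \<and> ((\<forall>v. converges_unconditionally (\<lambda>n. scale (m n * ip v (y n)) (x n))) \<longleftrightarrow>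
          (\<exists>c d :: nat \<Rightarrow> 'k. (\<forall>n. c n * sconj (d n) = m n) \<and>
             bessel_sequence ip (\<lambda>n. scale (c n) (x n)) \<and>
             bessel_sequence ip (\<lambda>n. scale (d n) (y n))))"
proof -
  interpret hilbert_space scale ip by (rule assms(1))
  let ?conv = "\<forall>v. converges_unconditionally (\<lambda>n. scale (m n * ip v (y n)) (x n))"
  let ?bessel = "bessel_sequence ip (\<lambda>n. scale (m n * of_real (norm (x n))) (y n))"
  let ?factor = "\<exists>c d :: nat \<Rightarrow> 'k. (\<forall>n. c n * sconj (d n) = m n) \<and>
    bessel_sequence ip (\<lambda>n. scale (c n) (x n)) \<and> bessel_sequence ip (\<lambda>n. scale (d n) (y n))"
  \<comment> \<open>Both equivalences follow from the cycle \<open>?conv\<close>,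
    \<open>?bessel\<close>, \<open>?factor\<close>, \<open>?conv\<close>.\<close>
  have "?conv \<Longrightarrow> ?bessel" by (rule bessel_sequence_if_converges_unconditionally) blast
  moreover have "?factor" if "?bessel"
  proof (intro exI conjI allI)
    \<comment> \<open>\<open>?c\<close> normalizes \<open>x\<close>, so normalizability applies
      directly; \<open>?d\<close> carries the rest of \<open>m\<close>, conjugated because the
      factorization conjugates it again.\<close>
    let ?c = "\<lambda>n. of_real (inverse (norm (x n))) :: 'k"
    let ?d = "\<lambda>n. sconj (m n) * of_real (norm (x n))"
    show "?c n * sconj (?d n) = m n" for n using assms(3)[of n] by (simp add: sconj_mult)
    show "bessel_sequence ip (\<lambda>n. scale (?c n) (x n))"
      using assms(4) by (simp only: bessel_normalizable_def scale_of_real)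
    show "bessel_sequence ip (\<lambda>n. scale (?d n) (y n))"
      using that by (subst bessel_sequence_cong_norm[where z' = "\<lambda>n. scale (m n * of_real (norm (x n))) (y n)"])
        (simp_all add: ip_scale_right norm_mult)
  qed
  moreover have "?conv" if ?factor
  proof
    fix v
    from that obtain c d where cd: "\<And>n. c n * sconj (d n) = m n"
      "bessel_sequence ip (\<lambda>n. scale (c n) (x n))" "bessel_sequence ip (\<lambda>n. scale (d n) (y n))"
      by blast
    show "converges_unconditionally (\<lambda>n. scale (m n * ip v (y n)) (x n))"
      using converges_unconditionally_bessel_pair[OF cd(2,3), of v] by (simp add: cd(1))
  qed
  ultimately show ?thesis by blast
qed

end
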